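(* Let $n\ge 1$, $w\in S_n$, and let $s_i=(i,i+1)\in S_n$ denote the transposition interchanging $i$ and $i+1$. For each $0\le\ell\le n$, $F_{n,\ell,w}=0$ if and only if $w\in Z_n$, where $$Z_n=\{s_{i_1}\cdots s_{i_p}\in S_n : |i_a-i_b|\ge 2 \text{ for all } a\neq b\}$$ (the empty product, i.e. the identity, being allowed).
   Context: $\mathbb K$ is a field of characteristic $0$; $[n]=\{1,\dots,n\}$; permutations $w\in S_n$ are written in one-line notation $w=(w_1,\dots,w_n)$. For $A=\{a_1<\dots<a_m\}$ and $B=\{b_1<\dots<b_m\}$ write $A\le B$ if $a_i\le b_i$ for all $i$. Put $S_w=\{J : \varnothing\ne J\subsetneq[n],\ J\not\le\{w_1,\dots,w_{|J|}\}\}$. Let $\mathbb K[P_J]$ be the polynomial ring in variables $P_J$, $\varnothing\neq J\subsetneq[n]$. For $J=\{j_1<\dots<j_k\}$ the block diagonal matching field $B_\ell$ assigns to $J$ the permutation $B_\ell(J)\in S_k$ which is the transposition $(12)$ if $k\ge2$ and $|J\cap\{1,\dots,\ell\}|=1$, and the identity otherwise. Let $\phi_\ell:\mathbb K[P_J]\to\mathbb K[x_{i,j}:1\le i\le n-1,1\le j\le n]$, $P_J\mapsto \mathrm{sgn}(\sigma)\,x_{\sigma(1),j_1}\cdots x_{\sigma(k),j_k}$ with $\sigma=B_\ell(J)$, and $F_{n,\ell}=\ker\phi_\ell$. Define $$F_{n,\ell,w}=(F_{n,\ell}+\langle P_J:J\in S_w\rangle)\cap\mathbb K[P_J:J\notin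 S_w].$$ *)

theory Defs
  imports
    "HOL-Library.Poly_Mapping"
    "HOL-Algebra.QuotRing"
    "HOL-Combinatorics.Permutations"
begin

text \<open>
  Multivariate polynomials are finitely supported functions from monomials to coefficients,
  and monomials are finitely supported exponent functions on the variables. The convolution
  product is the one provided by the library.
\<close>

type_synonym ('v, 'k) mpol = "('v \<Rightarrow>\<^sub>0 nat) \<Rightarrow>\<^sub>0 'k"

definition var :: "'v \<Rightarrow> ('v, 'k::zero_neq_one) mpol" where
  "var v = Poly_Mapping.single (Poly_Mapping.single v 1) 1"

definition const :: "'k::zero \<Rightarrow> ('v, 'k) mpol" where
  "const c = Poly_Mapping.single 0 c"

definition polys_in :: "'v set \<Rightarrow> ('v, 'k::zero) mpol set" where
  "polys_in V = {p. \<forall>m \<in> Poly_Mapping.keys p. Poly_Mapping.keys m \<subseteq> V}"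

definition poly_ring :: "'v set \<Rightarrow> ('v, 'k::comm_ring_1) mpol ring" where
  "poly_ring V =
     \<lparr>carrier = polys_in V, monoid.mult = (*), one = 1, zero = 0, add = (+)\<rparr>"

lemma polys_in_add: "p \<in> polys_in V \<Longrightarrow> q \<in> polys_in V \<Longrightarrow> p + q \<in> polys_in V"
  using Poly_Mapping.keys_add[of p q] unfolding polys_in_def by blast

lemma polys_in_uminus: "(p::('v,'k::comm_ring_1) mpol) \<in> polys_in V \<Longrightarrow> - p \<in> polys_in V"
  unfolding polys_in_def by simp

lemma polys_in_mult:
  assumes "p \<in> polys_in V" "q \<in> polys_in V"
  shows "p * q \<in> polys_in V"
proof -
  have "Poly_Mapping.keys m \<subseteq> V" if "m \<in> Poly_Mapping.keys (p*q)" for m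
  proof -
    from that keys_mult[of p q] obtain a b
      where "m = a + b" "a \<in> Poly_Mapping.keys p" "b \<in> Poly_Mapping.keys q"
      by blast
    then show ?thesis using assms Poly_Mapping.keys_add[of a b] unfolding polys_in_def by blast
  qed
  then show ?thesis by (simp add: polys_in_def)
qed

lemma cring_poly_ring: "cring (poly_ring V :: ('v,'k::comm_ring_1) mpol ring)"
proof (rule cringI)
  show "abelian_group (poly_ring V :: ('v,'k) mpol ring)"
  proof (rule abelian_groupI)
    fix x :: "('v,'k) mpol" assume "x \<in> carrier (poly_ring V)"
    then show "\<exists>y\<in>carrier (poly_ring V). y \<oplus>\<^bsub>poly_ring V\<^esub> x = \<zero>\<^bsub>poly_ring V\<^esub>"
      by (intro bexI[of _ "- x"]) (auto simp: poly_ring_def polys_in_uminus)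
  qed (auto simp: poly_ring_def polys_in_add add_ac, auto simp: polys_in_def)
  show "Group.comm_monoid (poly_ring V :: ('v,'k) mpol ring)"
    by (rule comm_monoidI) (auto simp: poly_ring_def polys_in_mult mult_ac, auto simp: polys_in_def)
qed (auto simp: poly_ring_def algebra_simps)

text \<open>The algebra homomorphism with \<open>v \<mapsto> f v\<close> on the variables.\<close>

definition subst_hom ::
    "('v \<Rightarrow> ('u, 'k) mpol) \<Rightarrow> ('v, 'k::comm_ring_1) mpol \<Rightarrow> ('u, 'k) mpol" where
  "subst_hom f p =
     (\<Sum>m \<in> Poly_Mapping.keys p.
        const (Poly_Mapping.lookup p m) *
        (\<Prod>v \<in> Poly_Mapping.keys m. f v ^ Poly_Mapping.lookup m v))"

text \<open>The componentwise order; it forces both (finite) sets to have the same cardinality.\<close>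

definition comp_le :: "nat set \<Rightarrow> nat set \<Rightarrow> bool" where
  "comp_le A B \<longleftrightarrow> list_all2 (\<le>) (sorted_list_of_set A) (sorted_list_of_set B)"

definition pluecker_index :: "nat \<Rightarrow> nat set set" where
  "pluecker_index n = {J. J \<noteq> {} \<and> J \<subset> {1..n}}"

text \<open>A permutation in one-line notation \<open>(w\<^sub>1, \<dots>, w\<^sub>n)\<close> is the function \<open>i \<mapsto> w\<^sub>i\<close>.\<close>

definition vanishing_index :: "nat \<Rightarrow> (nat \<Rightarrow> nat) \<Rightarrow> nat set set" where
  "vanishing_index n w = {J \<in> pluecker_index n. \<not> comp_le J (w ` {1..card J})}"

definition matching_field :: "nat \<Rightarrow> nat set \<Rightarrow> nat \<Rightarrow> nat" where
  "matching_field l J =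
     (if card J \<ge> 2 \<and> card (J \<inter> {1..l}) = 1 then transpose 1 2 else id)"

text \<open>
  The list of elements of \<open>J\<close> is indexed from \<open>0\<close>, so \<open>j\<^sub>r\<close> is its entry at position \<open>r - 1\<close>.
  The variable \<open>x\<^sub>i\<^sub>j\<close> is \<open>var (i, j)\<close>.
\<close>

definition matching_monomial :: "nat \<Rightarrow> nat set \<Rightarrow> (nat \<times> nat, 'k::comm_ring_1) mpol" where
  "matching_monomial l J =
     of_int (sign (matching_field l J)) *
     (\<Prod>r \<in> {1..card J}. var (matching_field l J r, sorted_list_of_set J ! (r - 1)))"

definition matching_map ::
    "nat \<Rightarrow> (nat set, 'k::comm_ring_1) mpol \<Rightarrow> (nat \<times> nat, 'k) mpol" where
  "matching_map l = subst_hom (matching_monomial l)"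

definition matching_ideal :: "nat \<Rightarrow> nat \<Rightarrow> (nat set, 'k::comm_ring_1) mpol set" where
  "matching_ideal n l =
     a_kernel (poly_ring (pluecker_index n)) (poly_ring ({1..n - 1} \<times> {1..n})) (matching_map l)"

definition restricted_matching_ideal ::
    "nat \<Rightarrow> nat \<Rightarrow> (nat \<Rightarrow> nat) \<Rightarrow> (nat set, 'k::comm_ring_1) mpol set" where
  "restricted_matching_ideal n l w =
     (matching_ideal n l
        <+>\<^bsub>poly_ring (pluecker_index n)\<^esub>
      genideal (poly_ring (pluecker_index n)) (var ` vanishing_index n w))
     \<inter> polys_in (pluecker_index n - vanishing_index n w)"

text \<open>
  Products \<open>s\<^bsub>i\<^sub>1\<^esub> \<cdots> s\<^bsub>i\<^sub>p\<^esub>\<close> of simple transpositions. The condition is on pairs of positions, so in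
  particular the indices are pairwise distinct.
\<close>

definition commuting_products :: "nat \<Rightarrow> (nat \<Rightarrow> nat) set" where
  "commuting_products n =
     {foldr (\<circ>) (map (\<lambda>i. transpose i (i + 1)) is) id | is.
        set is \<subseteq> {1..<n} \<and>
        (\<forall>a < length is. \<forall>b < length is.
           a \<noteq> b \<longrightarrow> \<bar>int (is ! a) - int (is ! b)\<bar> \<ge> 2)}"

end

theory Submission imports Defs begin

text \<open>
  The map \<open>\<phi>\<^sub>l\<close> sends every variable \<open>P\<^sub>J\<close> to plus or minus a monomial, so its kernel is spanned by
  binomials that compare two products of variables with the same image up to sign. Consequently
  the restricted ideal vanishes if and only if every product of nonvanishing variables is alone
  in its fibre: a second product in the fibre that avoids the vanishing variables gives a
  binomial in the ideal, and one that involves a vanishing variable shows that the first product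
  is itself in the ideal (lemmas \<open>subst_hom_terms_kernel\<close> and \<open>restricted_ideal_nonzero\<close>).

  The products of pairwise commuting simple transpositions are exactly the permutations \<open>w\<close> with
  \<open>\<bar>w x - x\<bar> \<le> 1\<close> for all \<open>x\<close> (\<open>commuting_products_iff\<close>), and this is the form in which the condition
  is used.

  Suppose that the bound holds. Then \<open>w\<close> is an involution, and the function \<open>x \<mapsto> x + w x\<close> is weakly
  increasing and constant only on the orbits of \<open>w\<close>. Among the sets \<open>J\<close> of size \<open>k\<close>, the total
  weight is least at \<open>{1, \<dots>, k}\<close> and, if \<open>w k = k + 1\<close>, at \<open>{1, \<dots>, k - 1, k + 1}\<close>; the nonvanishing
  sets are among these. The image of a product of variables determines how many sets there are of
  each size (by rows) and their total weight (by columns), whatever the matching field is.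
  So every product in the fibre of a product of nonvanishing variables consists of sets of
  least weight, and the row and column counts then give all multiplicities
  (\<open>nonvanishing_monomial_alone_in_fibre\<close>).

  Suppose that some point is moved by at least two. Then there is an \<open>i\<close> such that, with
  \<open>T = {1, \<dots>, i - 1}\<close>, the sets \<open>T \<union> {i + 1}\<close> and \<open>T \<union> {i, i + 2}\<close> are nonvanishing, and moving
  \<open>i + 2\<close> from the second to the first does not change the image of the product of the two
  variables. Only for \<open>i = 1\<close> and \<open>l \<in> {1, 2}\<close> does the matching field break this relation; there
  another two of the three terms of the Pluecker relation \<open>P\<^sub>1 P\<^sub>2\<^sub>3 - P\<^sub>2 P\<^sub>1\<^sub>3 + P\<^sub>3 P\<^sub>1\<^sub>2\<close> have the same
  image up to sign.
\<close>

section \<open>Homomorphisms that send variables to terms\<close>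

text \<open>
  A linear functional on exponent vectors. Equality of two exponents is used only through the
  row and column sums, which are functionals of this kind.
\<close>

definition wt :: "('v \<Rightarrow> nat) \<Rightarrow> ('v \<Rightarrow>\<^sub>0 nat) \<Rightarrow> nat" where
  "wt f m = (\<Sum>v \<in> Poly_Mapping.keys m. Poly_Mapping.lookup m v * f v)"

lemma wt_superset:
  assumes "finite A" "Poly_Mapping.keys m \<subseteq> A"
  shows "wt f m = (\<Sum>v \<in> A. Poly_Mapping.lookup m v * f v)"
  unfolding wt_def
  by (rule sum.mono_neutral_left) (use assms in \<open>auto simp: in_keys_iff\<close>)

lemma wt_0 [simp]: "wt f 0 = 0"
  by (simp add: wt_def)

lemma wt_add: "wt f (a + b) = wt f a + wt f b"
proof -
  let ?A = "Poly_Mapping.keys a \<union> Poly_Mapping.keys b"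
  have "wt f (a + b) = (\<Sum>v \<in> ?A. Poly_Mapping.lookup (a + b) v * f v)"
    by (rule wt_superset) (auto dest: subsetD[OF Poly_Mapping.keys_add])
  also have "\<dots> = wt f a + wt f b"
    by (simp add: wt_superset[of ?A a] wt_superset[of ?A b] lookup_add sum.distrib algebra_simps)
  finally show ?thesis .
qed

lemma wt_sum: "wt f (sum g A) = (\<Sum>i \<in> A. wt f (g i))"
  by (induction A rule: infinite_finite_induct) (auto simp: wt_add)

lemma wt_single [simp]: "wt f (Poly_Mapping.single v 1) = f v"
  by (simp add: wt_def)

lemma wt_indicator: "wt (\<lambda>u. of_bool (u = v)) m = Poly_Mapping.lookup m v"
proof -
  have "wt (\<lambda>u. of_bool (u = v)) m =
      (\<Sum>u \<in> insert v (Poly_Mapping.keys m). Poly_Mapping.lookup m u * of_bool (u = v))"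
    by (rule wt_superset) auto
  also have "\<dots> = (\<Sum>u \<in> {v}. Poly_Mapping.lookup m u * of_bool (u = v))"
    by (rule sum.mono_neutral_right) auto
  finally show ?thesis by simp
qed

lemma wt_cong: "(\<And>v. v \<in> Poly_Mapping.keys m \<Longrightarrow> f v = g v) \<Longrightarrow> wt f m = wt g m"
  by (simp add: wt_def)

lemma wt_fun_add: "wt (\<lambda>v. f v + g v) m = wt f m + wt g m"
  by (simp add: wt_def sum.distrib algebra_simps)

lemma wt_fun_sum: "wt (\<lambda>v. \<Sum>i \<in> I. c i * f i v) m = (\<Sum>i \<in> I. c i * wt (f i) m)"
proof -
  have "wt (\<lambda>v. \<Sum>i \<in> I. c i * f i v) m =
      (\<Sum>v \<in> Poly_Mapping.keys m. \<Sum>i \<in> I. c i * (Poly_Mapping.lookup m v * f i v))"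
    by (simp add: wt_def sum_distrib_left mult_ac)
  also have "\<dots> = (\<Sum>i \<in> I. c i * wt (f i) m)"
    by (subst sum.swap) (simp add: wt_def sum_distrib_left)
  finally show ?thesis .
qed

lemma wt_eq_imp_eq_on_keys:
  assumes "\<And>v. v \<in> Poly_Mapping.keys m \<Longrightarrow> f v \<le> g v" "wt f m = wt g m"
    and "v \<in> Poly_Mapping.keys m"
  shows "f v = g v"
proof (rule ccontr)
  assume "f v \<noteq> g v"
  then have "f v < g v" using assms(1,3) by fastforce
  then have "wt f m < wt g m"
    unfolding wt_def by (intro sum_strict_mono_ex1) (use assms in \<open>auto simp: in_keys_iff\<close>)
  then show False using assms(2) by simp
qed

text \<open>
  The exponent of the monomial \<open>m\<close> after each variable \<open>v\<close> is replaced by a term of exponent \<open>e v\<close>. The inner sum over a constant is the multiple \<open>m v \<cdot> e v\<close>.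
\<close>

definition term_exponent :: "('v \<Rightarrow> 'u \<Rightarrow>\<^sub>0 nat) \<Rightarrow> ('v \<Rightarrow>\<^sub>0 nat) \<Rightarrow> 'u \<Rightarrow>\<^sub>0 nat" where
  "term_exponent e m = (\<Sum>v \<in> Poly_Mapping.keys m. \<Sum>_ < Poly_Mapping.lookup m v. e v)"

lemma wt_term_exponent: "wt f (term_exponent e m) = wt (\<lambda>v. wt f (e v)) m"
  by (simp add: term_exponent_def wt_sum) (simp add: wt_def)

lemma prod_single:
  "(\<Prod>i \<in> A. Poly_Mapping.single (e i) (c i)) =
     (Poly_Mapping.single (\<Sum>i \<in> A. e i) (\<Prod>i \<in> A. c i) :: ('v, 'k::comm_ring_1) mpol)"
  by (induction A rule: infinite_finite_induct) (auto simp: mult_single)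

lemma subst_hom_terms:
  fixes c :: "'v \<Rightarrow> 'k::comm_ring_1"
  assumes "\<And>v. f v = Poly_Mapping.single (e v) (c v)"
  shows "subst_hom f p = (\<Sum>m \<in> Poly_Mapping.keys p. Poly_Mapping.single (term_exponent e m)
    (Poly_Mapping.lookup p m * (\<Prod>v \<in> Poly_Mapping.keys m. c v ^ Poly_Mapping.lookup m v)))"
proof -
  have "f v ^ k = Poly_Mapping.single (\<Sum>_ < k. e v) (c v ^ k)" for v k
    using prod_single[of "\<lambda>_. e v" "\<lambda>_. c v" "{..<k}"] assms by simp
  then show ?thesis
    by (simp add: subst_hom_def term_exponent_def prod_single const_def mult_single)
qed

text \<open>
  Terms cancel only within a fibre of the exponent map, so a monomial of an element of the
  kernel is never alone in its fibre.
\<close>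

lemma subst_hom_terms_kernel:
  fixes c :: "'v \<Rightarrow> 'k::idom"
  assumes f: "\<And>v. f v = Poly_Mapping.single (e v) (c v)" and c: "\<And>v. c v \<noteq> 0"
    and p: "subst_hom f p = 0" and m: "m \<in> Poly_Mapping.keys p"
  obtains m' where "m' \<in> Poly_Mapping.keys p" "m' \<noteq> m" "term_exponent e m' = term_exponent e m"
proof (rule ccontr)
  assume "\<not> thesis"
  with that have alone: "\<forall>m' \<in> Poly_Mapping.keys p. term_exponent e m' = term_exponent e m \<longrightarrow> m' = m"
    by blast
  define C where "C m' = Poly_Mapping.lookup p m' *
      (\<Prod>v \<in> Poly_Mapping.keys m'. c v ^ Poly_Mapping.lookup m' v)" for m'
  have "0 = Poly_Mapping.lookup (subst_hom f p) (term_exponent e m)"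
    using p by simp
  also have "\<dots> = (\<Sum>m' \<in> Poly_Mapping.keys p. Poly_Mapping.lookup
      (Poly_Mapping.single (term_exponent e m') (C m')) (term_exponent e m))"
    by (simp add: subst_hom_terms[OF f] C_def lookup_sum)
  also have "\<dots> = (\<Sum>m' \<in> {m}. Poly_Mapping.lookup
      (Poly_Mapping.single (term_exponent e m') (C m')) (term_exponent e m))"
    by (rule sum.mono_neutral_right) (use m alone in \<open>auto simp: lookup_single when_def\<close>)
  also have "\<dots> = C m" by simp
  finally show False using c m by (simp add: C_def in_keys_iff)
qed

lemma subst_hom_superset:
  assumes "finite A" "Poly_Mapping.keys p \<subseteq> A"
  shows "subst_hom f p = (\<Sum>m \<in> A. const (Poly_Mapping.lookup p m) *
    (\<Prod>v \<in> Poly_Mapping.keys m. f v ^ Poly_Mapping.lookup m v))"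
  unfolding subst_hom_def
  by (rule sum.mono_neutral_left) (use assms in \<open>auto simp: in_keys_iff const_def\<close>)

lemma subst_hom_add: "subst_hom f (p + q) = subst_hom f p + subst_hom f q"
proof -
  let ?A = "Poly_Mapping.keys p \<union> Poly_Mapping.keys q"
  have "subst_hom f (p + q) = (\<Sum>m \<in> ?A. const (Poly_Mapping.lookup (p + q) m) *
    (\<Prod>v \<in> Poly_Mapping.keys m. f v ^ Poly_Mapping.lookup m v))"
    by (rule subst_hom_superset) (auto dest: subsetD[OF Poly_Mapping.keys_add])
  also have "\<dots> = subst_hom f p + subst_hom f q"
    by (simp add: subst_hom_superset[of ?A p] subst_hom_superset[of ?A q] lookup_add const_def
        single_add sum.distrib algebra_simps)
  finally show ?thesis .
qed

lemma const_mult_var_mult_var: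
  "const c * (var a * var b) =
     (Poly_Mapping.single (Poly_Mapping.single a 1 + Poly_Mapping.single b 1) c :: ('v, 'k::comm_ring_1) mpol)"
  by (simp add: var_def mult_single const_def)

text \<open>
  The two variables may coincide, in which case the monomial is a square with a single key.
\<close>

lemma subst_hom_quadratic:
  "subst_hom f (const c * (var a * var b)) = const c * (f a * f b)"
  for c :: "'k::comm_ring_1"
proof (cases "a = b")
  case True
  then have "Poly_Mapping.keys (Poly_Mapping.single a (1::nat) + Poly_Mapping.single b 1) = {a}"
    by (simp flip: single_add)
  then show ?thesis using True
    unfolding const_mult_var_mult_var
    by (cases "c = 0") (auto simp: subst_hom_def lookup_add const_def simp del: One_nat_def
        simp flip: power2_eq_square)
next
  case False
  then have "Poly_Mapping.keys (Poly_Mapping.single a (1::nat) + Poly_Mapping.single b 1) = {a, b}"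
    by (auto simp: in_keys_iff lookup_add lookup_single when_def split: if_splits)
  then show ?thesis using False
    unfolding const_mult_var_mult_var
    by (cases "c = 0") (auto simp: subst_hom_def lookup_add lookup_single_not_eq const_def
        simp del: One_nat_def)
qed

lemma polys_in_var [simp]: "v \<in> V \<Longrightarrow> (var v :: ('v, 'k::zero_neq_one) mpol) \<in> polys_in V"
  by (simp add: var_def polys_in_def)

lemma polys_in_const [simp]: "const c \<in> polys_in V"
  by (cases "c = 0") (auto simp: const_def polys_in_def)

text \<open>
  The polynomials all of whose monomials have this property form an ideal that contains the
  generators.
\<close>

lemma genideal_variables:
  fixes p :: "('v, 'k::comm_ring_1) mpol"
  assumes "S \<subseteq> V" and p: "p \<in> genideal (poly_ring V) (var ` S)" and m: "m \<in> Poly_Mapping.keys p"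
  shows "Poly_Mapping.keys m \<subseteq> V \<and> Poly_Mapping.keys m \<inter> S \<noteq> {}"
proof -
  define R where "R = (poly_ring V :: ('v, 'k) mpol ring)"
  define I where "I = {p :: ('v, 'k) mpol. \<forall>m \<in> Poly_Mapping.keys p.
      Poly_Mapping.keys m \<subseteq> V \<and> Poly_Mapping.keys m \<inter> S \<noteq> {}}"
  interpret cring R unfolding R_def by (rule cring_poly_ring)
  have uminus: "\<ominus>\<^bsub>R\<^esub> x = - x" if "x \<in> carrier R" for x
    by (rule minus_equality)
      (use that in \<open>auto simp: R_def poly_ring_def polys_in_uminus\<close>)
  have add: "x + y \<in> I" if "x \<in> I" "y \<in> I" for x y
    using that Poly_Mapping.keys_add[of x y] unfolding I_def by blast
  have mult: "x * y \<in> I" if "x \<in> carrier R" "y \<in> I" for x y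
  proof -
    have "Poly_Mapping.keys m \<subseteq> V \<and> Poly_Mapping.keys m \<inter> S \<noteq> {}"
      if "m \<in> Poly_Mapping.keys (x * y)" for m
    proof -
      from that keys_mult[of x y] obtain a b
        where ab: "m = a + b" "a \<in> Poly_Mapping.keys x" "b \<in> Poly_Mapping.keys y"
        by blast
      have "Poly_Mapping.keys a \<subseteq> V" "Poly_Mapping.keys b \<subseteq> V" "Poly_Mapping.keys b \<inter> S \<noteq> {}"
        using ab \<open>x \<in> carrier R\<close> \<open>y \<in> I\<close> by (auto simp: R_def poly_ring_def polys_in_def I_def)
      moreover have "Poly_Mapping.keys m = Poly_Mapping.keys a \<union> Poly_Mapping.keys b"
        unfolding ab(1) by (auto simp: in_keys_iff lookup_add)
      ultimately show ?thesis by blast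
    qed
    then show ?thesis by (simp add: I_def)
  qed
  have sub: "I \<subseteq> carrier R"
    by (auto simp: I_def R_def poly_ring_def polys_in_def)
  have "ideal I R"
  proof (rule idealI)
    show "ring R" by (rule ring_axioms)
    show "subgroup I (add_monoid R)"
    proof (rule add.subgroupI)
      show "I \<subseteq> carrier R" by (rule sub)
      have "0 \<in> I" by (simp add: I_def)
      then show "I \<noteq> {}" by blast
      show "\<ominus>\<^bsub>R\<^esub> a \<in> I" if "a \<in> I" for a
        using that subsetD[OF sub that] by (simp add: uminus) (simp add: I_def)
      show "a \<oplus>\<^bsub>R\<^esub> b \<in> I" if "a \<in> I" "b \<in> I" for a b
        using add[OF that] by (simp add: R_def poly_ring_def)
    qed
    show "x \<otimes>\<^bsub>R\<^esub> a \<in> I" "a \<otimes>\<^bsub>R\<^esub> x \<in> I" if "a \<in> I" "x \<in> carrier R" for a x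
      using mult[OF that(2,1)] by (simp_all add: R_def poly_ring_def mult.commute)
  qed
  moreover have "var ` S \<subseteq> I"
    using \<open>S \<subseteq> V\<close> by (auto simp: I_def var_def)
  ultimately have "p \<in> I"
    using genideal_minimal p unfolding R_def by blast
  then show ?thesis using m by (simp add: I_def)
qed

section \<open>The monomials of the block diagonal matching field\<close>

abbreviation entry :: "nat set \<Rightarrow> nat \<Rightarrow> nat" where
  "entry J r \<equiv> sorted_list_of_set J ! (r - 1)"

definition matching_exponent :: "nat \<Rightarrow> nat set \<Rightarrow> (nat \<times> nat) \<Rightarrow>\<^sub>0 nat" where
  "matching_exponent l J =
     (\<Sum>r \<in> {1..card J}. Poly_Mapping.single (matching_field l J r, entry J r) 1)"

lemma matching_monomial_single:
  "matching_monomial l J =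
     (Poly_Mapping.single (matching_exponent l J) (of_int (sign (matching_field l J)))
       :: (nat \<times> nat, 'k::comm_ring_1) mpol)"
proof -
  have "matching_monomial l J = (Poly_Mapping.single 0 (of_int (sign (matching_field l J))) *
      Poly_Mapping.single (matching_exponent l J) 1 :: (nat \<times> nat, 'k) mpol)"
    by (simp add: matching_monomial_def matching_exponent_def var_def prod_single)
  then show ?thesis
    by (simp only: mult_single add_0 mult_1_right)
qed

lemma matching_field_permutes: "matching_field l J permutes {1..card J}"
  by (auto simp: matching_field_def permutes_swap_id permutes_id)

lemma bij_betw_entry:
  assumes "finite J"
  shows "bij_betw (entry J) {1..card J} J"
proof -
  have "bij_betw ((!) (sorted_list_of_set J)) {..<card J} J"
    using assms by (intro bij_betw_nth) auto
  moreover have "bij_betw (\<lambda>r. r - 1) {1..card J} {..<card J}"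
    by (rule bij_betw_byWitness[where f' = Suc]) auto
  ultimately show ?thesis
    using bij_betw_trans by (fastforce simp: o_def)
qed

lemma sum_entry: "finite J \<Longrightarrow> (\<Sum>r \<in> {1..card J}. f (entry J r)) = sum f J"
  by (rule sum.reindex_bij_betw) (rule bij_betw_entry)

text \<open>
  A matching field only permutes the rows within \<open>{1, \<dots>, |J|}\<close>. Hence the number of factors in
  a given row depends on \<open>|J|\<close> alone, and the columns that occur are those in \<open>J\<close>, whatever the
  matching field is.
\<close>

lemma row_weight:
  "wt (\<lambda>p. of_bool (fst p = i)) (matching_exponent l J) = of_bool (i \<in> {1..card J})"
proof -
  have "wt (\<lambda>p. of_bool (fst p = i)) (matching_exponent l J) =
      (\<Sum>r \<in> {1..card J}. of_bool (matching_field l J r = i))"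
    by (simp add: matching_exponent_def wt_sum del: One_nat_def)
  also have "\<dots> = (\<Sum>r \<in> {1..card J}. of_bool (r = i))"
    by (rule sum.reindex_bij_betw[OF permutes_imp_bij[OF matching_field_permutes]])
  also have "\<dots> = of_bool (i \<in> {1..card J})"
    by (simp add: of_bool_def)
  finally show ?thesis .
qed

lemma column_weight:
  assumes "finite J"
  shows "wt (\<lambda>p. of_bool (snd p = j)) (matching_exponent l J) = of_bool (j \<in> J)"
proof -
  have "wt (\<lambda>p. of_bool (snd p = j)) (matching_exponent l J) =
      (\<Sum>r \<in> {1..card J}. of_bool (entry J r = j))"
    by (simp add: matching_exponent_def wt_sum del: One_nat_def)
  also have "\<dots> = (\<Sum>x \<in> J. of_bool (x = j))"
    using assms by (rule sum_entry)
  also have "\<dots> = of_bool (j \<in> J)"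
    using assms by (simp add: of_bool_def)
  finally show ?thesis .
qed

lemma sorted_list_of_set_insert_greater:
  assumes "finite J" "\<And>x. x \<in> J \<Longrightarrow> x < c"
  shows "sorted_list_of_set (insert c J) = sorted_list_of_set J @ [c]"
proof (rule sorted_list_of_set_unique[THEN iffD1])
  show "finite (insert c J)" using assms by simp
  have "c \<notin> J" using assms(2) by blast
  then show "sorted_wrt (<) (sorted_list_of_set J @ [c]) \<and> set (sorted_list_of_set J @ [c]) = insert c J
      \<and> length (sorted_list_of_set J @ [c]) = card (insert c J)"
    using assms by (auto simp: sorted_wrt_append)
qed

text \<open>
  Appending a new largest element to \<open>J\<close> multiplies the monomial of \<open>J\<close> by one variable in the
  next row, unless this affects the choice between the identity and the transposition.
\<close>

lemma matching_monomial_insert_greater: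
  assumes "finite J" "\<And>x. x \<in> J \<Longrightarrow> x < c"
    and same: "matching_field l (insert c J) = matching_field l J"
  shows "matching_monomial l (insert c J) =
    (matching_monomial l J * var (card J + 1, c) :: (nat \<times> nat, 'k::comm_ring_1) mpol)"
proof -
  have "c \<notin> J" using assms(2) by blast
  then have card: "card (insert c J) = Suc (card J)" using assms(1) by simp
  have xs: "sorted_list_of_set (insert c J) = sorted_list_of_set J @ [c]"
    by (rule sorted_list_of_set_insert_greater) (use assms in auto)
  have len: "length (sorted_list_of_set J) = card J"
    using assms(1) by simp
  have last: "matching_field l J (Suc (card J)) = Suc (card J)"
    using matching_field_permutes[of l J] by (rule permutes_not_in) simp
  have "(\<Prod>r \<in> {1..card J}. var (matching_field l J r, (sorted_list_of_set J @ [c]) ! (r - 1))) =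
      (\<Prod>r \<in> {1..card J}. var (matching_field l J r, entry J r) :: (nat \<times> nat, 'k) mpol)"
    by (rule prod.cong) (auto simp: nth_append len)
  then show ?thesis
    by (simp add: matching_monomial_def card same xs last nth_append len mult_ac)
qed

lemma matching_field_insert_greater:
  assumes J: "finite J" "\<And>x. x \<in> J \<Longrightarrow> x < c" "\<And>x. x \<in> J \<Longrightarrow> 1 \<le> x" "J \<noteq> {}"
    and l: "card J \<ge> 2 \<or> l \<notin> {1..<c}"
  shows "matching_field l (insert c J) = matching_field l J"
proof (cases "c \<le> l")
  case True
  have "c \<ge> 1" using J(2,4) by fastforce
  moreover have "J \<subseteq> {1..l}" using J(2,3) True by fastforce
  ultimately have "insert c J \<inter> {1..l} = insert c J" "J \<inter> {1..l} = J"
    using True by auto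
  moreover have "\<not> (k \<ge> 2 \<and> k = 1)" for k :: nat by simp
  ultimately show ?thesis by (simp only: matching_field_def if_False)
next
  case False
  have inter: "insert c J \<inter> {1..l} = J \<inter> {1..l}"
    using False by auto
  show ?thesis
  proof (cases "card J \<ge> 2")
    case True
    moreover have "card (insert c J) \<ge> card J"
      using J(1) by (simp add: card_insert_le)
    ultimately have "card (insert c J) \<ge> 2" by linarith
    with True show ?thesis unfolding matching_field_def inter by simp
  next
    case card: False
    then have "J \<inter> {1..l} = {}"
      using l \<open>\<not> c \<le> l\<close> by auto
    then show ?thesis unfolding matching_field_def inter by simp
  qed
qed

lemma matching_monomial_singleton:
  "matching_monomial l {a} = (var (1, a) :: (nat \<times> nat, 'k::comm_ring_1) mpol)"
  by (simp add: matching_monomial_def matching_field_def)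

lemma matching_monomial_pair:
  assumes "a < b"
  shows "matching_monomial l {a, b} =
    (if card ({a, b} \<inter> {1..l}) = 1 then - (var (2, a) * var (1, b)) else var (1, a) * var (2, b)
      :: (nat \<times> nat, 'k::comm_ring_1) mpol)"
proof -
  have xs: "sorted_list_of_set {a, b} = [a, b]" and card: "card {a, b} = 2"
    using assms by auto
  have field: "matching_field l {a, b} =
      (if card ({a, b} \<inter> {1..l}) = 1 then transpose 1 2 else id)"
    by (simp only: matching_field_def card) simp
  have "{1..2::nat} = {1, 2}" by auto
  then have "matching_monomial l {a, b} =
      (of_int (sign (matching_field l {a, b})) * (var (matching_field l {a, b} 1, a) *
        var (matching_field l {a, b} 2, b)) :: (nat \<times> nat, 'k) mpol)"
    unfolding matching_monomial_def xs card by simp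
  then show ?thesis
    unfolding field by (auto simp: sign_swap_id mult_ac simp del: One_nat_def)
qed

section \<open>Permutations of displacement at most one\<close>

definition small_displacement :: "(nat \<Rightarrow> nat) \<Rightarrow> bool" where
  "small_displacement w \<longleftrightarrow> (\<forall>x. w x \<le> x + 1 \<and> x \<le> w x + 1)"

text \<open>
  If \<open>x\<close> goes up to \<open>x + 1\<close> and \<open>x\<close> is not reached from \<open>x + 1\<close>, it is reached from \<open>x - 1\<close>, so
  \<open>x - 1\<close> goes up too, and the upward chain would reach below \<open>1\<close>.
\<close>

lemma small_displacement_up:
  assumes w: "w permutes {1..n}" and d: "small_displacement w" and x: "w x = x + 1"
  shows "w (x + 1) = x"
  using x
proof (induction x)
  case 0
  then show ?case using permutes_not_in[OF w, of 0] by simp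
next
  case (Suc x)
  obtain y where y: "w y = Suc x"
    using permutes_surj[OF w] by (metis surjD)
  have "y \<le> Suc x + 1" "Suc x \<le> y + 1"
    using d[unfolded small_displacement_def, rule_format, of y] y by auto
  then consider "y = x" | "y = Suc x" | "y = Suc x + 1" by linarith
  then show ?case
  proof cases
    case 1
    then show ?thesis using Suc y by simp
  next
    case 2
    then show ?thesis using Suc y by simp
  next
    case 3
    then show ?thesis using y by simp
  qed
qed

text \<open>
  If \<open>x\<close> did not go back up to \<open>x + 1\<close>, it would have to go down as well, and the chain
  \<open>x + 1 \<mapsto> x \<mapsto> x - 1 \<mapsto> \<cdots>\<close> would leave \<open>{1, \<dots>, n}\<close>.
\<close>

lemma small_displacement_down:
  assumes w: "w permutes {1..n}" and d: "small_displacement w" and x: "w (x + 1) = x"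
  shows "w x = x + 1"
  using x
proof (induction x)
  case 0
  then show ?case
    using permutes_not_in[OF w, of 0] injD[OF permutes_inj[OF w], of 1 0] by simp
next
  case (Suc x)
  have inj: "inj w" by (rule permutes_inj[OF w])
  have "w (Suc x) \<le> Suc x + 1" "Suc x \<le> w (Suc x) + 1"
    using d unfolding small_displacement_def by blast+
  then consider "w (Suc x) = x" | "w (Suc x) = Suc x" | "w (Suc x) = Suc x + 1" by linarith
  then show ?case
  proof cases
    case 1
    then have "w x = w (Suc x + 1)" using Suc by simp
    then show ?thesis using injD[OF inj, of x "Suc x + 1"] by simp
  next
    case 2
    then have "w (Suc x) = w (Suc x + 1)" using Suc by simp
    then show ?thesis using injD[OF inj, of "Suc x" "Suc x + 1"] by simp
  next
    case 3
    then show ?thesis .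
  qed
qed

lemma small_displacement_involution:
  assumes "w permutes {1..n}" "small_displacement w"
  shows "w (w x) = x"
proof -
  have "w x \<le> x + 1" "x \<le> w x + 1"
    using assms(2) unfolding small_displacement_def by auto
  then consider "w x = x" | "w x = x + 1" | "w x + 1 = x" by linarith
  then show ?thesis
  proof cases
    case 3
    then show ?thesis using small_displacement_down[OF assms, of "w x"] by simp
  qed (use small_displacement_up[OF assms, of x] in simp_all)
qed

abbreviation simple_product :: "nat list \<Rightarrow> nat \<Rightarrow> nat" where
  "simple_product ks \<equiv> foldr (\<circ>) (map (\<lambda>i. transpose i (i + 1)) ks) id"

lemma simple_product_apply:
  assumes "distinct ks" "\<And>i. i \<in> set ks \<Longrightarrow> i + 1 \<notin> set ks"
  shows "simple_product ks x =
    (if x \<in> set ks then x + 1 else if x \<ge> 1 \<and> x - 1 \<in> set ks then x - 1 else x)"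
  using assms
proof (induction ks arbitrary: x)
  case Nil
  then show ?case by simp
next
  case (Cons i js)
  define y where "y = simple_product js x"
  have y: "y = (if x \<in> set js then x + 1 else if x \<ge> 1 \<and> x - 1 \<in> set js then x - 1 else x)"
    unfolding y_def by (rule Cons.IH) (use Cons.prems in auto)
  have i: "i \<notin> set js" "i + 1 \<notin> set js" "\<And>j. j \<in> set js \<Longrightarrow> j + 1 \<noteq> i"
    using Cons.prems by auto
  have not_i: "x \<noteq> i" if "x \<ge> 1" "x - 1 \<in> set js"
    using i(3)[OF that(2)] that(1) by simp
  have "simple_product (i # js) x = transpose i (i + 1) y"
    by (simp add: y_def)
  also have "\<dots> = (if x \<in> set (i # js) then x + 1
      else if x \<ge> 1 \<and> x - 1 \<in> set (i # js) then x - 1 else x)"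
  proof -
    consider "x \<in> set js" | "x \<notin> set js" "x \<ge> 1" "x - 1 \<in> set js"
      | "x \<notin> set js" "\<not> (x \<ge> 1 \<and> x - 1 \<in> set js)" by blast
    then show ?thesis
    proof cases
      case 1
      then have "y = x + 1" "x \<noteq> i" "x + 1 \<noteq> i" using y i by auto
      then show ?thesis using 1 by simp
    next
      case 2
      then have "y = x - 1" "x \<noteq> i" "x - 1 \<noteq> i" "x - 1 \<noteq> i + 1" using y i not_i by auto
      then show ?thesis using 2 by simp
    next
      case 3
      then have "y = x" using y by auto
      then show ?thesis using 3 by (cases "x = i"; cases "x = i + 1") auto
    qed
  qed
  finally show ?case .
qed

text \<open>
  The order of the factors is immaterial, so such a product is determined by the set of its
  factors, and this set is recovered from \<open>w\<close> as the set of ascents \<open>w x = x + 1\<close>.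
\<close>

lemma commuting_products_iff:
  assumes w: "w permutes {1..n}"
  shows "w \<in> commuting_products n \<longleftrightarrow> small_displacement w"
proof
  assume "w \<in> commuting_products n"
  then obtain ks where ks: "w = simple_product ks" and
    far: "\<forall>a < length ks. \<forall>b < length ks. a \<noteq> b \<longrightarrow> \<bar>int (ks ! a) - int (ks ! b)\<bar> \<ge> 2"
    unfolding commuting_products_def by auto
  have "distinct ks"
    using far by (fastforce simp: distinct_conv_nth)
  moreover have "i + 1 \<notin> set ks" if i: "i \<in> set ks" for i
  proof
    assume "i + 1 \<in> set ks"
    then obtain b where "b < length ks" "ks ! b = i + 1"
      unfolding in_set_conv_nth by blast
    moreover obtain a where "a < length ks" "ks ! a = i"
      using i unfolding in_set_conv_nth by blast
    ultimately show False using far[rule_format, of a b] by (cases "a = b") auto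
  qed
  ultimately show "small_displacement w"
    unfolding small_displacement_def ks by (subst (1 2) simple_product_apply) auto
next
  assume d: "small_displacement w"
  define I where "I = {x. w x = x + 1}"
  have sub: "I \<subseteq> {1..<n}"
  proof
    fix x assume "x \<in> I"
    then have "w x \<noteq> x" by (simp add: I_def)
    then have "x \<in> {1..n}" "w x \<in> {1..n}" 
      using permutes_not_in[OF w, of x] permutes_in_image[OF w, of x] by auto
    then show "x \<in> {1..<n}" using \<open>x \<in> I\<close> by (simp add: I_def)
  qed
  then have fin: "finite I" by (rule finite_subset) simp
  have adj: "i + 1 \<notin> I" if "i \<in> I" for i
    using that small_displacement_up[OF w d, of i] by (simp add: I_def)
  define ks where "ks = sorted_list_of_set I"
  have ks: "distinct ks" "set ks = I" using fin by (auto simp: ks_def)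
  have "w x = simple_product ks x" for x
  proof -
    have "simple_product ks x =
        (if x \<in> I then x + 1 else if x \<ge> 1 \<and> x - 1 \<in> I then x - 1 else x)"
      using simple_product_apply[of ks x] ks adj by auto
    moreover have "w x \<le> x + 1" "x \<le> w x + 1"
      using d unfolding small_displacement_def by auto
    moreover have "w x + 1 = x \<longleftrightarrow> x \<ge> 1 \<and> x - 1 \<in> I"
      using small_displacement_up[OF w d, of "x - 1"] small_displacement_down[OF w d, of "x - 1"]
      by (auto simp: I_def)
    ultimately show ?thesis by (auto simp: I_def)
  qed
  then have "w = simple_product ks" by blast
  moreover have "\<bar>int (ks ! a) - int (ks ! b)\<bar> \<ge> 2"
    if ab: "a < length ks" "b < length ks" "a \<noteq> b" for a b
  proof -
    have "ks ! a \<noteq> ks ! b" using ab ks(1) by (simp add: nth_eq_iff_index_eq)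
    moreover have "ks ! a \<in> I" "ks ! b \<in> I" using ab ks(2) nth_mem by blast+
    then have "ks ! a + 1 \<noteq> ks ! b" "ks ! b + 1 \<noteq> ks ! a"
      using adj by metis+
    ultimately show ?thesis by linarith
  qed
  ultimately show "w \<in> commuting_products n"
    unfolding commuting_products_def using sub ks(2) by blast
qed

section \<open>Weights that single out the nonvanishing index sets\<close>

lemma entry_strict_mono:
  assumes "finite J" "1 \<le> r" "r < s" "s \<le> card J"
  shows "entry J r < entry J s"
  using assms sorted_wrt_nth_less[OF strict_sorted_list_of_set, of "r - 1" "s - 1" J] by simp

lemma entry_mem:
  assumes "finite J" "1 \<le> r" "r \<le> card J"
  shows "entry J r \<in> J"
  using bij_betwE[OF bij_betw_entry[OF assms(1)]] assms by simp

lemma entry_ge: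
  assumes J: "finite J" "0 \<notin> J" and r: "1 \<le> r" "r \<le> card J"
  shows "r \<le> entry J r"
  using r
proof (induction r)
  case (Suc r)
  show ?case
  proof (cases "r = 0")
    case True
    then show ?thesis using entry_mem[OF J(1), of 1] Suc.prems J(2) by (cases "entry J 1") auto
  next
    case False
    then have "r \<le> entry J r" using Suc by simp
    also have "entry J r < entry J (Suc r)"
      using False Suc.prems J(1) by (intro entry_strict_mono) auto
    finally show ?thesis by simp
  qed
qed simp

lemma comp_le_entry:
  assumes "comp_le A B" "finite A" "finite B"
  shows "card A = card B" and "\<And>r. 1 \<le> r \<Longrightarrow> r \<le> card A \<Longrightarrow> entry A r \<le> entry B r"
  using assms by (auto simp: comp_le_def list_all2_conv_all_nth)

text \<open>
  If \<open>w\<close> moves every point by at most one, it is an involution, and the weight \<open>x + w x\<close> is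
  weakly increasing and constant precisely on its orbits. Since \<open>w ` {1..k}\<close> has the same total
  weight as \<open>{1..k}\<close>, the least one for its size, all sets between the two have this weight too.
\<close>

abbreviation weight :: "(nat \<Rightarrow> nat) \<Rightarrow> nat \<Rightarrow> nat" where
  "weight w x \<equiv> x + w x"

definition minimal_weight :: "(nat \<Rightarrow> nat) \<Rightarrow> nat set \<Rightarrow> bool" where
  "minimal_weight w J \<longleftrightarrow> sum (weight w) J = sum (weight w) {1..card J}"

lemma weight_mono:
  assumes d: "small_displacement w" and "x \<le> y"
  shows "weight w x \<le> weight w y"
proof (cases "y = x + 1")
  case True
  have "w x \<le> x + 1" "y \<le> w y + 1"
    using d unfolding small_displacement_def by auto
  then show ?thesis using True by simp
next
  case False
  have "w x \<le> x + 1" "y \<le> w y + 1"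
    using d unfolding small_displacement_def by auto
  then show ?thesis using False \<open>x \<le> y\<close> by (cases "x = y") auto
qed

lemma weight_eq_less:
  assumes d: "small_displacement w" and "x < y" "weight w x = weight w y"
  shows "y = x + 1" "w x = x + 1"
proof -
  have "w x \<le> x + 1" "y \<le> w y + 1"
    using d unfolding small_displacement_def by auto
  then show "y = x + 1" "w x = x + 1" using assms(2,3) by linarith+
qed

lemma weight_lower_bound:
  assumes "small_displacement w" "finite J" "0 \<notin> J"
  shows "sum (weight w) {1..card J} \<le> sum (weight w) J"
proof -
  have "sum (weight w) {1..card J} \<le> (\<Sum>r \<in> {1..card J}. weight w (entry J r))"
    by (rule sum_mono) (rule weight_mono[OF assms(1) entry_ge], use assms in auto)
  also have "\<dots> = sum (weight w) J"
    using assms(2) by (rule sum_entry)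
  finally show ?thesis .
qed

lemma comp_le_minimal_weight:
  assumes w: "w permutes {1..n}" and d: "small_displacement w" and J: "finite J" "0 \<notin> J"
    and le: "comp_le J (w ` {1..card J})"
  shows "minimal_weight w J"
proof -
  let ?A = "w ` {1..card J}"
  have inj: "inj_on w {1..card J}" by (rule permutes_inj_on[OF w])
  have "sum (weight w) J = (\<Sum>r \<in> {1..card J}. weight w (entry J r))"
    using sum_entry[OF J(1), of "weight w"] by (rule sym)
  also have "\<dots> \<le> (\<Sum>r \<in> {1..card J}. weight w (entry ?A r))"
    by (rule sum_mono) (rule weight_mono[OF d], use comp_le_entry(2)[OF le J(1)] in auto)
  also have "\<dots> = sum (weight w) ?A"
    using sum_entry[of ?A "weight w"] card_image[OF inj] by simp
  also have "\<dots> = sum (weight w) {1..card J}"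
    by (subst sum.reindex[OF inj]) (rule sum.cong, simp_all add: small_displacement_involution[OF w d])
  finally show ?thesis
    unfolding minimal_weight_def using weight_lower_bound[OF d J] by (rule antisym)
qed

text \<open>
  The \<open>r\<close>-th smallest element of \<open>J\<close> is at least \<open>r\<close>, so equality of the totals forces equality of
  weights entry by entry: each entry is \<open>r\<close>, or \<open>r + 1\<close> when \<open>w\<close> swaps the two. Only the last entry
  can be raised.
\<close>

lemma minimal_weight_cases:
  assumes w: "w permutes {1..n}" and d: "small_displacement w" and J: "finite J" "0 \<notin> J" "J \<noteq> {}"
    and min: "minimal_weight w J"
  obtains "J = {1..card J}" | "w (card J) = card J + 1" "J = insert (card J + 1) {1..card J - 1}"
proof -
  define k where "k = card J"
  have k: "k \<ge> 1" using J by (simp add: k_def Suc_leI card_gt_0_iff)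
  have ge: "r \<le> entry J r" if "r \<in> {1..k}" for r
    using that entry_ge[OF J(1,2)] by (simp add: k_def)
  have eq: "weight w r = weight w (entry J r)" if r: "r \<in> {1..k}" for r
  proof (rule ccontr)
    assume "weight w r \<noteq> weight w (entry J r)"
    then have "weight w r < weight w (entry J r)"
      using weight_mono[OF d ge[OF r]] by simp
    then have "sum (weight w) {1..k} < (\<Sum>r \<in> {1..k}. weight w (entry J r))"
      using r weight_mono[OF d ge] by (intro sum_strict_mono_ex1) blast+
    also have "\<dots> = sum (weight w) J"
      unfolding k_def using J(1) by (rule sum_entry)
    finally show False using min by (simp add: minimal_weight_def k_def)
  qed
  have entry_eq: "entry J r = r \<or> entry J r = r + 1 \<and> w r = r + 1" if r: "r \<in> {1..k}" for r
  proof (cases "entry J r = r")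
    case False
    then have "r < entry J r" using ge[OF r] by simp
    from weight_eq_less[OF d this eq[OF r]] show ?thesis by simp
  qed simp
  \<comment> \<open>Two consecutive entries cannot both be raised: \<open>w\<close> would have to map \<open>r + 1\<close> both to \<open>r\<close> and to \<open>r + 2\<close>.\<close>
  have lower: "entry J r = r" if r: "r \<in> {1..k - 1}" for r
  proof (rule ccontr)
    assume "entry J r \<noteq> r"
    then have up: "entry J r = r + 1" "w r = r + 1" using entry_eq[of r] r by auto
    have "entry J r < entry J (r + 1)"
      using r J(1) by (intro entry_strict_mono) (auto simp: k_def)
    then have "entry J (r + 1) \<noteq> r + 1" using up by simp
    then have "w (r + 1) = r + 2" using entry_eq[of "r + 1"] r by auto
    then show False using small_displacement_up[OF w d up(2)] by simp
  qed
  have "J = entry J ` {1..k}"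
    using bij_betw_entry[OF J(1)] by (simp add: bij_betw_def k_def)
  also have "{1..k} = insert k {1..k - 1}" using k by auto
  finally have J_eq: "J = insert (entry J k) {1..k - 1}"
    using lower by (auto simp: image_iff)
  consider "entry J k = k" | "entry J k = k + 1" "w k = k + 1"
    using entry_eq[of k] k by auto
  then show thesis
  proof cases
    case 1
    then have "J = {1..k}" using J_eq k by auto
    then show thesis using that(1) by (simp add: k_def)
  next
    case 2
    then have "J = insert (k + 1) {1..k - 1}" using J_eq by simp
    then show thesis using that(2) 2(2) by (simp add: k_def)
  qed
qed

text \<open>
  Two identities recover the multiplicities of the sets of minimal weight from the row and column
  counts. If \<open>w k = k + 1\<close>, all sets of minimal weight with more than \<open>k\<close> elements contain \<open>k + 1\<close>,
  and \<open>{1, \<dots>, k - 1, k + 1}\<close> is the only other one that does. The sets that reach row \<open>k\<close> but not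
  row \<open>k + 1\<close> are those of size \<open>k\<close>, of which there are at most two of minimal weight.
\<close>

lemma minimal_weight_raised_count:
  assumes w: "w permutes {1..n}" and d: "small_displacement w" and J: "finite J" "0 \<notin> J" "J \<noteq> {}"
    and min: "minimal_weight w J" and k: "1 \<le> k" "w k = k + 1"
  shows "(of_bool (k + 1 \<in> J) :: nat) =
    of_bool (k + 1 \<in> {1..card J}) + of_bool (J = insert (k + 1) {1..k - 1})"
  using w d J min
proof (cases rule: minimal_weight_cases)
  case 1
  have mem: "x \<in> J \<longleftrightarrow> x \<in> {1..card J}" for x
    using 1 by (rule arg_cong)
  have "J \<noteq> insert (k + 1) {1..k - 1}"
  proof
    assume "J = insert (k + 1) {1..k - 1}"
    then have "k + 1 \<in> J" "k \<notin> J" using k by auto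
    then show False using mem[of k] mem[of "k + 1"] k by simp
  qed
  then show ?thesis using mem[of "k + 1"] by simp
next
  case 2
  have "card J \<noteq> k + 1"
    using small_displacement_up[OF w d k(2)] 2(1) by auto
  moreover have "card J = k" if "J = insert (k + 1) {1..k - 1}"
    using that k by simp
  moreover have "k + 1 \<in> J \<longleftrightarrow> k + 1 = card J + 1 \<or> k + 1 \<in> {1..card J - 1}"
    by (subst 2(2)) simp
  moreover have "J = insert (k + 1) {1..k - 1}" if "card J = k"
    using 2(2) that by simp
  ultimately show ?thesis by (cases "card J = k") auto
qed

lemma minimal_weight_initial_count:
  assumes w: "w permutes {1..n}" and d: "small_displacement w" and J: "finite J" "0 \<notin> J" "J \<noteq> {}"
    and min: "minimal_weight w J" and k: "1 \<le> k"
  shows "(of_bool (k \<in> {1..card J}) :: nat) = of_bool (k + 1 \<in> {1..card J}) + of_bool (J = {1..k}) +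
    of_bool (w k = k + 1 \<and> J = insert (k + 1) {1..k - 1})"
proof -
  let ?K = "insert (k + 1) {1..k - 1}"
  have "k \<in> {1..k}" "k \<notin> ?K" using k by auto
  then have disjoint: "{1..k} \<noteq> ?K" by blast
  have card: "card {1..k} = k" "card ?K = k" using k by simp_all
  have "J = {1..k} \<or> w k = k + 1 \<and> J = ?K" if "card J = k"
    using w d J min by (cases rule: minimal_weight_cases) (use that in auto)
  then have size: "card J = k \<longleftrightarrow> J = {1..k} \<or> w k = k + 1 \<and> J = ?K"
    using card by blast
  have row: "k \<in> {1..card J} \<longleftrightarrow> k + 1 \<in> {1..card J} \<or> card J = k"
    "\<not> (k + 1 \<in> {1..card J} \<and> card J = k)"
    using k by auto
  have exclusive: "\<not> (J = {1..k} \<and> w k = k + 1 \<and> J = ?K)" using disjoint by blast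
  have count: "(of_bool A :: nat) = of_bool B + of_bool D + of_bool E"
    if "A \<longleftrightarrow> B \<or> C" "\<not> (B \<and> C)" "C \<longleftrightarrow> D \<or> E" "\<not> (D \<and> E)" for A B C D E
    using that by auto
  show ?thesis by (rule count[OF row size exclusive])
qed

abbreviation nonvanishing_index :: "nat \<Rightarrow> (nat \<Rightarrow> nat) \<Rightarrow> nat set set" where
  "nonvanishing_index n w \<equiv> pluecker_index n - vanishing_index n w"

lemma sum_subset_of_bool:
  fixes f :: "'a \<Rightarrow> nat"
  assumes "finite A" "B \<subseteq> A"
  shows "sum f B = (\<Sum>x \<in> A. f x * of_bool (x \<in> B))"
  by (rule sum.mono_neutral_cong_left) (use assms in auto)

lemma pluecker_indexD:
  assumes "J \<in> pluecker_index n"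
  shows "finite J" "0 \<notin> J" "J \<noteq> {}" "J \<subseteq> {1..n}"
  using assms by (auto simp: pluecker_index_def intro: finite_subset)

text \<open>
  The total weight of a product of variables \<open>P\<^sub>J\<close> can be read off its image from the columns, and
  the least possible weight from the rows. Hence a product with the same image as a product of
  nonvanishing variables consists of sets of minimal weight too, and the previous counts show
  that both are equal.
\<close>

lemma nonvanishing_monomial_alone_in_fibre:
  assumes w: "w permutes {1..n}" and d: "small_displacement w"
    and m: "Poly_Mapping.keys m \<subseteq> nonvanishing_index n w"
    and m': "Poly_Mapping.keys m' \<subseteq> pluecker_index n"
    and same: "term_exponent (matching_exponent l) m' = term_exponent (matching_exponent l) m"
  shows "m' = m"
proof -
  have index: "J \<in> pluecker_index n" if "J \<in> Poly_Mapping.keys m \<union> Poly_Mapping.keys m'" for J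
    using that m m' by auto
  have row: "wt (\<lambda>J. of_bool (i \<in> {1..card J})) m' = wt (\<lambda>J. of_bool (i \<in> {1..card J})) m" for i
    using arg_cong[OF same, of "wt (\<lambda>p. of_bool (fst p = i))"]
    unfolding wt_term_exponent row_weight .
  have column: "wt (\<lambda>J. of_bool (j \<in> J)) m' = wt (\<lambda>J. of_bool (j \<in> J)) m" for j
  proof -
    have "wt (\<lambda>J. of_bool (j \<in> J)) q = wt (\<lambda>p. of_bool (snd p = j)) (term_exponent (matching_exponent l) q)"
      if "q = m \<or> q = m'" for q
      unfolding wt_term_exponent
      by (rule wt_cong, subst column_weight) (use that index pluecker_indexD in auto)
    then show ?thesis using same by simp
  qed
  have total: "wt (sum (weight w)) m' = wt (sum (weight w)) m"
  proof -
    have "wt (sum (weight w)) q = (\<Sum>j \<in> {1..n}. weight w j * wt (\<lambda>J. of_bool (j \<in> J)) q)"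
      if "q = m \<or> q = m'" for q
    proof -
      have "sum (weight w) J = (\<Sum>j \<in> {1..n}. weight w j * of_bool (j \<in> J))"
        if "J \<subseteq> {1..n}" for J
        using that by (intro sum_subset_of_bool) auto
      then have "wt (sum (weight w)) q = wt (\<lambda>J. \<Sum>j \<in> {1..n}. weight w j * of_bool (j \<in> J)) q"
        by (intro wt_cong) (use that index pluecker_indexD(4) in blast)
      then show ?thesis by (simp only: wt_fun_sum)
    qed
    then show ?thesis by (simp add: column)
  qed
  have least: "wt (\<lambda>J. sum (weight w) {1..card J}) m' = wt (\<lambda>J. sum (weight w) {1..card J}) m"
  proof -
    have "wt (\<lambda>J. sum (weight w) {1..card J}) q =
        (\<Sum>i \<in> {1..n}. weight w i * wt (\<lambda>J. of_bool (i \<in> {1..card J})) q)"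
      if "q = m \<or> q = m'" for q
    proof -
      have "sum (weight w) {1..card J} = (\<Sum>i \<in> {1..n}. weight w i * of_bool (i \<in> {1..card J}))"
        if "J \<in> pluecker_index n" for J
      proof -
        have "card J \<le> n" using card_mono[OF _ pluecker_indexD(4)[OF that]] by simp
        then show ?thesis by (intro sum_subset_of_bool) auto
      qed
      then have "wt (\<lambda>J. sum (weight w) {1..card J}) q =
          wt (\<lambda>J. \<Sum>i \<in> {1..n}. weight w i * of_bool (i \<in> {1..card J})) q"
        by (intro wt_cong) (use that index in blast)
      then show ?thesis by (simp only: wt_fun_sum)
    qed
    from this[of m] this[of m'] show ?thesis by (simp only: row simp_thms)
  qed
  have minimal_m: "minimal_weight w J" if "J \<in> Poly_Mapping.keys m" for J
  proof -
    have "J \<in> nonvanishing_index n w" using that m by auto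
    then show ?thesis
      using comp_le_minimal_weight[OF w d] pluecker_indexD by (auto simp: vanishing_index_def)
  qed
  have minimal_m': "minimal_weight w J" if "J \<in> Poly_Mapping.keys m'" for J
  proof -
    have "wt (\<lambda>J. sum (weight w) {1..card J}) m' = wt (sum (weight w)) m'"
      unfolding least total by (rule wt_cong) (rule minimal_m[unfolded minimal_weight_def, symmetric])
    moreover have "sum (weight w) {1..card v} \<le> sum (weight w) v" if "v \<in> Poly_Mapping.keys m'" for v
      by (rule weight_lower_bound[OF d]) (use that index pluecker_indexD in blast)+
    ultimately have "sum (weight w) {1..card J} = sum (weight w) J"
      using wt_eq_imp_eq_on_keys[of m' "\<lambda>J. sum (weight w) {1..card J}" "sum (weight w)" J] that
      by blast
    then show ?thesis by (simp add: minimal_weight_def)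
  qed
  have good: "finite J" "0 \<notin> J" "J \<noteq> {}" "minimal_weight w J"
    if "J \<in> Poly_Mapping.keys m \<union> Poly_Mapping.keys m'" for J
    using that index pluecker_indexD minimal_m minimal_m' by blast+
  have raised: "Poly_Mapping.lookup m' (insert (k + 1) {1..k - 1}) =
      Poly_Mapping.lookup m (insert (k + 1) {1..k - 1})" if k: "1 \<le> k" "w k = k + 1" for k
  proof -
    have "wt (\<lambda>J. of_bool (k + 1 \<in> J)) q = wt (\<lambda>J. of_bool (k + 1 \<in> {1..card J})) q +
        Poly_Mapping.lookup q (insert (k + 1) {1..k - 1})" if "q = m \<or> q = m'" for q
      unfolding wt_indicator[symmetric] wt_fun_add[symmetric]
      by (rule wt_cong) (rule minimal_weight_raised_count[OF w d], use that k good in auto)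
    from this[of m] this[of m'] show ?thesis using column[of "k + 1"] row[of "k + 1"] by simp
  qed
  have initial: "Poly_Mapping.lookup m' {1..k} = Poly_Mapping.lookup m {1..k}" if k: "1 \<le> k" for k
  proof -
    have split: "wt (\<lambda>J. of_bool (k \<in> {1..card J})) q =
        wt (\<lambda>J. of_bool (k + 1 \<in> {1..card J})) q + Poly_Mapping.lookup q {1..k} +
        wt (\<lambda>J. of_bool (w k = k + 1 \<and> J = insert (k + 1) {1..k - 1})) q" if "q = m \<or> q = m'" for q
      unfolding wt_indicator[symmetric] wt_fun_add[symmetric]
      by (rule wt_cong) (rule minimal_weight_initial_count[OF w d], use that k good in auto)
    have "wt (\<lambda>J. of_bool (w k = k + 1 \<and> J = insert (k + 1) {1..k - 1})) m' =
        wt (\<lambda>J. of_bool (w k = k + 1 \<and> J = insert (k + 1) {1..k - 1})) m"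
    proof (cases "w k = k + 1")
      case True
      then show ?thesis using raised[OF k True] by (simp only: simp_thms wt_indicator)
    next
      case False
      then show ?thesis by (simp add: wt_def)
    qed
    with split[of m] split[of m'] show ?thesis using row[of k] row[of "k + 1"] by simp
  qed
  show "m' = m"
  proof (rule poly_mapping_eqI)
    fix J
    show "Poly_Mapping.lookup m' J = Poly_Mapping.lookup m J"
    proof (cases "J \<in> Poly_Mapping.keys m \<union> Poly_Mapping.keys m'")
      case True
      have "1 \<le> card J" using good[OF True] by (simp add: Suc_leI card_gt_0_iff)
      from w d good[OF True] show ?thesis
      proof (cases rule: minimal_weight_cases)
        case 1
        then show ?thesis using initial[OF \<open>1 \<le> card J\<close>] by simp
      next
        case 2
        then show ?thesis using raised[OF \<open>1 \<le> card J\<close> 2(1)] by simp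
      qed
    next
      case False
      then show ?thesis by (simp add: in_keys_iff)
    qed
  qed
qed

section \<open>Quadratic relations outside the displacement bound\<close>

text \<open>
  Only the last entry of \<open>{1, \<dots>, i, y}\<close> can exceed the smallest possible value for its position, so
  only the largest element of \<open>A\<close> matters.
\<close>

lemma comp_le_insert_atLeastAtMost:
  assumes A: "finite A" "0 \<notin> A" "card A = i + 1" and y: "i + 1 \<le> y" "y \<le> z" "z \<in> A"
  shows "comp_le (insert y {1..i}) A"
proof -
  have "sorted_list_of_set {1..i} = [1..<i + 1]"
    using sorted_list_of_set_range[of 1 "i + 1"] by (simp add: atLeastLessThanSuc_atLeastAtMost)
  then have xs: "sorted_list_of_set (insert y {1..i}) = [1..<i + 1] @ [y]"
    using y(1) by (subst sorted_list_of_set_insert_greater) auto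
  have len: "length (sorted_list_of_set A) = i + 1" using A by simp
  have "([1..<i + 1] @ [y]) ! r \<le> sorted_list_of_set A ! r" if "r < i + 1" for r
  proof (cases "r = i")
    case True
    have "z \<in> entry A ` {1..card A}"
      unfolding bij_betw_imp_surj_on[OF bij_betw_entry[OF A(1)]] by (rule y(3))
    then obtain s where s: "s \<in> {1..card A}" "z = entry A s" by blast
    then have "entry A s \<le> entry A (i + 1)"
      using entry_strict_mono[of A s "i + 1"] A by (cases "s = i + 1") (auto simp: less_imp_le)
    then show ?thesis using True s y(2) by (simp add: nth_append del: upt_Suc)
  next
    case False
    then show ?thesis using entry_ge[OF A(1,2), of "r + 1"] A(3) that by (simp add: nth_append del: upt_Suc)
  qed
  then show ?thesis unfolding comp_le_def xs list_all2_conv_all_nth using len by (simp del: upt_Suc)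
qed

lemma comp_le_23:
  assumes "card A = 2" "0 \<notin> A" "1 \<notin> A"
  shows "comp_le {2, 3} A"
proof -
  have fin: "finite A" using assms(1) by (metis card.infinite zero_neq_numeral)
  have two: "entry A 1 \<ge> 2"
    using entry_mem[OF fin, of 1] assms by (cases "entry A 1 = 0"; cases "entry A 1 = 1") auto
  moreover have "entry A 2 > entry A 1"
    using assms(1) by (intro entry_strict_mono[OF fin]) auto
  ultimately have "entry A 2 \<ge> 3" by linarith
  with two have "\<forall>r < 2. [2, 3] ! r \<le> sorted_list_of_set A ! r"
    by (auto simp: less_2_cases_iff)
  moreover have "sorted_list_of_set {2, 3 :: nat} = [2, 3]" by simp
  ultimately show ?thesis
    using assms(1) by (simp add: comp_le_def list_all2_conv_all_nth)
qed

lemma image_permutes_atLeastAtMost: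
  assumes "w permutes {1..n}"
  shows "finite (w ` {1..k})" "0 \<notin> w ` {1..k}" "card (w ` {1..k}) = k"
proof -
  show "0 \<notin> w ` {1..k}"
  proof
    assume "0 \<in> w ` {1..k}"
    then obtain x where x: "w x = 0" "x \<in> {1..k}" by force
    have "w 0 = 0" by (rule permutes_not_in[OF assms]) simp
    then show False using injD[OF permutes_inj[OF assms], of x 0] x by simp
  qed
  show "card (w ` {1..k}) = k"
    using card_image[OF permutes_inj_on[OF assms]] by simp
qed simp

lemma nonvanishing_insert:
  assumes w: "w permutes {1..n}" and i: "i + 2 \<le> n" and y: "i + 1 \<le> y" "y \<le> n"
    and z: "z \<in> w ` {1..i + 1}" "y \<le> z"
  shows "insert y {1..i} \<in> nonvanishing_index n w"
proof -
  have card: "card (insert y {1..i}) = i + 1" using y(1) by simp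
  have "insert y {1..i} \<noteq> {1..n}" using card i by auto
  then have "insert y {1..i} \<in> pluecker_index n"
    using y i by (auto simp: pluecker_index_def)
  moreover have "comp_le (insert y {1..i}) (w ` {1..i + 1})"
    by (rule comp_le_insert_atLeastAtMost) (use image_permutes_atLeastAtMost[OF w] y z in auto)
  ultimately show ?thesis by (simp add: vanishing_index_def card del: One_nat_def)
qed

text \<open>
  If a point \<open>x\<close> moves up by two or more, then \<open>i = x\<close> and \<open>z = z' = w x\<close> will do. If it moves down
  by two or more, then \<open>u = w x\<close> is missing from the images of \<open>{1, \<dots>, i}\<close> and \<open>{1, \<dots>, i + 1}\<close> for
  \<open>i = x - 2\<close>, and by counting each of them has an element outside the initial segment.
\<close>

lemma large_displacement:
  assumes w: "w permutes {1..n}" and d: "\<not> small_displacement w"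
  obtains i z z' where "1 \<le> i" "i + 2 \<le> n" "z \<in> w ` {1..i}" "i + 1 \<le> z"
    "z' \<in> w ` {1..i + 1}" "i + 2 \<le> z'"
    "i + 2 \<le> z \<or> (\<exists>u. 1 \<le> u \<and> u \<le> i \<and> u \<notin> w ` {1..i + 1})"
proof -
  obtain x where "\<not> (w x \<le> x + 1 \<and> x \<le> w x + 1)"
    using d unfolding small_displacement_def by blast
  then have x: "w x \<ge> x + 2 \<or> x \<ge> w x + 2" by linarith
  then have "w x \<noteq> x" by auto
  then have mem: "x \<in> {1..n}" using permutes_not_in[OF w] by blast
  then have wmem: "w x \<in> {1..n}" using permutes_in_image[OF w] by simp
  show thesis
  proof (cases "w x \<ge> x + 2")
    case True
    show thesis
      by (rule that[of x "w x" "w x"]) (use True mem wmem in auto)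
  next
    case False
    then have le: "x \<ge> w x + 2" using x by simp
    define i where "i = x - 2"
    have i: "1 \<le> w x" "w x \<le> i" "x = i + 2" "1 \<le> i"
      using le wmem by (auto simp: i_def)
    have missing: "w x \<notin> w ` {1..k}" if "k \<le> i + 1" for k
    proof
      assume "w x \<in> w ` {1..k}"
      then obtain y where "w x = w y" "y \<in> {1..k}" by blast
      then show False using injD[OF permutes_inj[OF w], of x y] that i(3) by simp
    qed
    have large: "\<exists>z \<in> w ` {1..k}. k + 1 \<le> z" if k: "i \<le> k" "k \<le> i + 1" for k
    proof (rule ccontr)
      assume "\<not> ?thesis"
      then have "w ` {1..k} \<subseteq> {1..k}"
        using image_permutes_atLeastAtMost(2)[OF w, of k] by (fastforce simp: Suc_le_eq not_less)
      then have "w ` {1..k} = {1..k}"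
        using image_permutes_atLeastAtMost(3)[OF w, of k] by (intro card_subset_eq) auto
      then show False using missing[OF k(2)] i k by auto
    qed
    obtain z where z: "z \<in> w ` {1..i}" "i + 1 \<le> z"
      using large[of i] by auto
    obtain z' where z': "z' \<in> w ` {1..i + 1}" "i + 2 \<le> z'"
      using large[of "i + 1"] by auto
    show thesis
      by (rule that[OF i(4) _ z z']) (use mem i missing[of "i + 1"] in auto)
  qed
qed

lemma sum_single_neq:
  assumes "a \<noteq> c" "a \<noteq> d"
  shows "Poly_Mapping.single a 1 + Poly_Mapping.single b 1 \<noteq>
    (Poly_Mapping.single c 1 + Poly_Mapping.single d 1 :: 'v \<Rightarrow>\<^sub>0 nat)"
proof
  assume "Poly_Mapping.single a 1 + Poly_Mapping.single b 1 =
    (Poly_Mapping.single c 1 + Poly_Mapping.single d 1 :: 'v \<Rightarrow>\<^sub>0 nat)"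
  from arg_cong[OF this, of "\<lambda>m. Poly_Mapping.lookup m a"] show False
    using assms by (simp add: lookup_add lookup_single_not_eq)
qed

text \<open>
  A binomial relation with a nonvanishing monomial yields a nonzero element: the binomial itself
  if its other monomial is nonvanishing too, and otherwise the nonvanishing monomial alone.
\<close>

lemma restricted_ideal_nonzero:
  fixes e :: "'k::idom"
  assumes ab: "a \<in> nonvanishing_index n w" "b \<in> nonvanishing_index n w"
    and cd: "c \<in> pluecker_index n" "d \<in> pluecker_index n"
    and relation: "matching_monomial l a * matching_monomial l b =
      const e * (matching_monomial l c * matching_monomial l d)"
    and neq: "a \<noteq> c" "a \<noteq> d"
  shows "restricted_matching_ideal n l w \<noteq> {0 :: (nat set, 'k) mpol}"
proof -
  define V where "V = pluecker_index n"
  define S where "S = vanishing_index n w"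
  define R where "R = (poly_ring V :: (nat set, 'k) mpol ring)"
  define p where "p = (const 1 * (var a * var b) :: (nat set, 'k) mpol)"
  define q where "q = (const e * (var c * var d) :: (nat set, 'k) mpol)"
  define K where "K = (matching_ideal n l :: (nat set, 'k) mpol set)"
  define G where "G = genideal R (var ` S :: (nat set, 'k) mpol set)"
  interpret cring R unfolding R_def by (rule cring_poly_ring)
  have S: "S \<subseteq> V" by (auto simp: S_def V_def vanishing_index_def)
  then have vars: "var ` S \<subseteq> carrier R" by (auto simp: R_def poly_ring_def)
  interpret G: ideal G R unfolding G_def by (rule genideal_ideal) (rule vars)
  have p_in: "p \<in> polys_in (V - S)"
    unfolding p_def using ab by (intro polys_in_mult) (auto simp: V_def S_def)
  have q_in: "q \<in> polys_in W" if "c \<in> W" "d \<in> W" for W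
    unfolding q_def using that by (intro polys_in_mult) auto
  have p_keys: "Poly_Mapping.lookup p (Poly_Mapping.single a 1 + Poly_Mapping.single b 1) = 1"
    unfolding p_def const_mult_var_mult_var by simp
  have q_keys: "Poly_Mapping.lookup q (Poly_Mapping.single a 1 + Poly_Mapping.single b 1) = 0"
    unfolding q_def const_mult_var_mult_var using sum_single_neq[OF neq]
    by (intro lookup_single_not_eq) metis
  have "- q = const (- e) * (var c * var d)"
    by (simp add: q_def const_mult_var_mult_var single_uminus)
  then have "p - q = p + const (- e) * (var c * var d)" by (metis diff_conv_add_uminus)
  then have "matching_map l (p - q) = const 1 * (matching_monomial l a * matching_monomial l b) +
      const (- e) * (matching_monomial l c * matching_monomial l d :: (nat \<times> nat, 'k) mpol)"
    by (simp only: matching_map_def p_def subst_hom_quadratic subst_hom_add)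
  also have "\<dots> = 0"
    by (simp add: relation const_def single_uminus)
  finally have "matching_map l (p - q) = 0" .
  moreover have "p - q \<in> polys_in V"
    using polys_in_add[of p V "- q"] polys_in_uminus[OF q_in[of V]] p_in cd
    by (auto simp: V_def polys_in_def)
  ultimately have K: "p - q \<in> K"
    by (simp add: K_def matching_ideal_def a_kernel_def' poly_ring_def V_def)
  have sum: "h + g \<in> restricted_matching_ideal n l w"
    if "h \<in> K" "g \<in> G" "h + g \<in> polys_in (V - S)" for h g
    using that unfolding restricted_matching_ideal_def K_def G_def R_def V_def S_def
    by (auto simp: set_add_def' poly_ring_def)
  show ?thesis
  proof (cases "c \<in> S \<or> d \<in> S")
    case True
    have closed: "var c' * (const e * var d') \<in> G" if "c' \<in> S" "d' \<in> V" for c' d'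
    proof -
      have "var c' \<in> G" using genideal_self[OF vars] that(1) by (auto simp: G_def)
      moreover have "const e * var d' \<in> carrier R"
        using that(2) by (auto simp: R_def poly_ring_def intro!: polys_in_mult)
      ultimately show ?thesis using G.I_r_closed by (simp add: R_def poly_ring_def)
    qed
    have "q = var c * (const e * var d)" "q = var d * (const e * var c)"
      by (simp_all add: q_def mult_ac)
    then have "q \<in> G" using True closed[of c d] closed[of d c] cd unfolding V_def by metis
    then have "p \<in> restricted_matching_ideal n l w"
      using sum[OF K, of q] p_in by simp
    moreover have "p \<noteq> 0" using p_keys by auto
    ultimately show ?thesis by blast
  next
    case False
    then have "q \<in> polys_in (V - S)" using cd by (intro q_in) (auto simp: V_def)
    then have "p - q \<in> polys_in (V - S)"
      using polys_in_add[OF p_in polys_in_uminus, of q] by simp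
    moreover have "0 \<in> G" using G.zero_closed by (simp add: R_def poly_ring_def)
    ultimately have "p - q \<in> restricted_matching_ideal n l w"
      using sum[OF K, of 0] by simp
    moreover have "p - q \<noteq> 0"
      using p_keys q_keys by (metis lookup_minus lookup_zero diff_zero zero_neq_one)
    ultimately show ?thesis by blast
  qed
qed

text \<open>
  For \<open>T = {1, \<dots>, i - 1}\<close>, the element \<open>i + 2\<close> is appended to \<open>T \<union> {i}\<close> or to \<open>T \<union> {i + 1}\<close>; either way
  the image gains the factor \<open>x\<^sub>i\<^sub>+\<^sub>1\<^sub>,\<^sub>i\<^sub>+\<^sub>2\<close>. For \<open>i = 1\<close> this fails if
  \<open>l \<in> {1, 2}\<close>: the matching field then transposes \<open>{1, 3}\<close>, but never a singleton.
\<close>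

lemma restricted_ideal_nonzero_of_large_displacement:
  assumes w: "w permutes {1..n}" and d: "\<not> small_displacement w"
  shows "restricted_matching_ideal n l w \<noteq> {0 :: (nat set, 'k::idom) mpol}"
proof -
  obtain i z z' where i: "1 \<le> i" "i + 2 \<le> n"
    and z: "z \<in> w ` {1..i}" "i + 1 \<le> z" and z': "z' \<in> w ` {1..i + 1}" "i + 2 \<le> z'"
    and alt: "i + 2 \<le> z \<or> (\<exists>u. 1 \<le> u \<and> u \<le> i \<and> u \<notin> w ` {1..i + 1})"
    using large_displacement[OF w d] by metis
  have small: "insert y {1..i - 1} \<in> nonvanishing_index n w" if "i \<le> y" "y \<le> z" "y \<le> n" for y
    by (rule nonvanishing_insert[OF w]) (use i z that in auto)
  have big: "insert y {1..i} \<in> nonvanishing_index n w"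
    if "i + 1 \<le> y" "y \<le> i + 2" for y
    by (rule nonvanishing_insert[OF w i(2) _ _ z'(1)]) (use i z'(2) that in auto)
  have index: "J \<in> pluecker_index n" if "J \<subseteq> {1..n}" "J \<noteq> {}" "x \<in> {1..n}" "x \<notin> J" for J x
    using that by (auto simp: pluecker_index_def)
  consider "i \<ge> 2 \<or> l \<notin> {1, 2}" | "i = 1" "l = 1" | "i = 1" "l = 2"
    using i(1) by fastforce
  then show ?thesis
  proof cases
    case 1
    let ?a = "insert (i + 1) {1..i - 1}"
    have card: "card ?a = i" "card {1..i} = i" using i by simp_all
    have l: "i \<ge> 2 \<or> l \<notin> {1..<i + 2}"
    proof (cases "i \<ge> 2")
      case False
      then have "i = 1" using i(1) by simp
      then show ?thesis using 1 by auto
    qed simp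
    have "matching_monomial l (insert (i + 2) J) =
        (matching_monomial l J * var (i + 1, i + 2) :: (nat \<times> nat, 'k) mpol)"
      if J: "J \<subseteq> {1..i + 1}" "card J = i" for J
    proof -
      have fin: "finite J" and less: "\<And>x. x \<in> J \<Longrightarrow> x < i + 2" and pos: "\<And>x. x \<in> J \<Longrightarrow> 1 \<le> x"
        and "J \<noteq> {}"
        using J i(1) by (auto intro: finite_subset dest: subsetD)
      have same: "matching_field l (insert (i + 2) J) = matching_field l J"
        by (rule matching_field_insert_greater[OF fin less pos \<open>J \<noteq> {}\<close>]) (use l J(2) in auto)
      have "matching_monomial l (insert (i + 2) J) =
          (matching_monomial l J * var (card J + 1, i + 2) :: (nat \<times> nat, 'k) mpol)"
        by (rule matching_monomial_insert_greater[OF fin less same])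
      then show ?thesis by (simp only: J(2))
    qed
    from this[of "{1..i}"] this[of ?a]
    have "matching_monomial l ?a * matching_monomial l (insert (i + 2) {1..i}) =
        (const 1 * (matching_monomial l {1..i} * matching_monomial l (insert (i + 2) ?a))
          :: (nat \<times> nat, 'k) mpol)"
      using card by (simp add: const_def mult_ac)
    then show ?thesis
    proof (rule restricted_ideal_nonzero[rotated 4])
      show "?a \<in> nonvanishing_index n w" using z i by (intro small) auto
      show "insert (i + 2) {1..i} \<in> nonvanishing_index n w" by (intro big) auto
      show "{1..i} \<in> pluecker_index n" by (rule index[of _ n]) (use i in auto)
      show "insert (i + 2) ?a \<in> pluecker_index n" by (rule index[of _ i]) (use i in auto)
      have "i + 1 \<in> ?a" "i + 1 \<notin> {1..i}" by auto
      then show "?a \<noteq> {1..i}" by metis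
      have "i + 2 \<notin> ?a" "i + 2 \<in> insert (i + 2) ?a" by auto
      then show "?a \<noteq> insert (i + 2) ?a" by metis
    qed
  next
    case 2
    \<comment> \<open>Here \<open>P\<^sub>2 P\<^sub>1\<^sub>3\<close> and \<open>P\<^sub>3 P\<^sub>1\<^sub>2\<close> have the same image.\<close>
    have "{1, 3} \<inter> {1..l} = {1::nat}" "{1, 2} \<inter> {1..l} = {1::nat}" using 2 by auto
    then have "matching_monomial l {2} * matching_monomial l {1, 3} =
        (const 1 * (matching_monomial l {3} * matching_monomial l {1, 2}) :: (nat \<times> nat, 'k) mpol)"
      by (simp add: matching_monomial_singleton matching_monomial_pair const_def mult_ac)
    then show ?thesis
    proof (rule restricted_ideal_nonzero[rotated 4])
      show "{2} \<in> nonvanishing_index n w" using small[of 2] 2 z i by simp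
      show "{1, 3} \<in> nonvanishing_index n w" using big[of 3] 2 by (simp add: insert_commute)
      show "{3} \<in> pluecker_index n" by (rule index[of _ 1]) (use 2 i in auto)
      show "{1, 2} \<in> pluecker_index n" by (rule index[of _ 3]) (use 2 i in auto)
      show "{2} \<noteq> {3::nat}" "{2} \<noteq> {1, 2::nat}" by auto
    qed
  next
    case 3
    \<comment> \<open>Here \<open>P\<^sub>1 P\<^sub>2\<^sub>3\<close> and \<open>P\<^sub>3 P\<^sub>1\<^sub>2\<close> have opposite images; which of the two is nonvanishing depends on the
      direction in which \<open>w\<close> moves a point far.\<close>
    have "{2, 3} \<inter> {1..l} = {2::nat}" "{1, 2} \<inter> {1..l} = {1, 2::nat}" using 3 by auto
    then have pairs: "matching_monomial l {2, 3} = (- (var (2, 2) * var (1, 3)) :: (nat \<times> nat, 'k) mpol)"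
      "matching_monomial l {1, 2} = (var (1, 1) * var (2, 2) :: (nat \<times> nat, 'k) mpol)"
      by (subst matching_monomial_pair; simp)+
    have minus_one: "const (- 1) = (- 1 :: (nat \<times> nat, 'k) mpol)"
      by (simp only: const_def single_uminus single_one)
    have relation: "matching_monomial l {1} * matching_monomial l {2, 3} =
        (const (- 1) * (matching_monomial l {3} * matching_monomial l {1, 2}) :: (nat \<times> nat, 'k) mpol)"
      unfolding pairs minus_one matching_monomial_singleton by (simp add: mult_ac)
    have index': "{1} \<in> pluecker_index n" "{3} \<in> pluecker_index n" "{1, 2} \<in> pluecker_index n"
      "{2, 3} \<in> pluecker_index n"
      using index[of "{1}" 2] index[of "{3}" 1] index[of "{1, 2}" 3] index[of "{2, 3}" 1] 3 i by auto
    from alt show ?thesis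
    proof
      assume "i + 2 \<le> z"
      have "{3} \<in> nonvanishing_index n w" using small[of 3] 3 \<open>i + 2 \<le> z\<close> i by simp
      moreover have "{1, 2} \<in> nonvanishing_index n w" using big[of 2] 3 by (simp add: insert_commute)
      moreover have "matching_monomial l {3} * matching_monomial l {1, 2} =
        (const (- 1) * (matching_monomial l {1} * matching_monomial l {2, 3}) :: (nat \<times> nat, 'k) mpol)"
        unfolding relation minus_one by simp
      ultimately show ?thesis
        using index' by (intro restricted_ideal_nonzero[of "{3}" n w "{1, 2}" "{1}" "{2, 3}"]) auto
    next
      assume "\<exists>u. 1 \<le> u \<and> u \<le> i \<and> u \<notin> w ` {1..i + 1}"
      then have "1 \<notin> w ` {1..2}" using 3 by (metis le_antisym one_add_one)
      then have "comp_le {2, 3} (w ` {1..2})"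
        using image_permutes_atLeastAtMost[OF w, of 2] by (intro comp_le_23) auto
      then have "{2, 3} \<in> nonvanishing_index n w" using index' by (simp add: vanishing_index_def numeral_2_eq_2)
      moreover have "{1} \<in> nonvanishing_index n w" using small[of 1] 3 z i by simp
      ultimately show ?thesis
        using index' relation
        by (intro restricted_ideal_nonzero[of "{1}" n w "{2, 3}" "{3}" "{1, 2}"]) auto
    qed
  qed
qed

section \<open>The vanishing criterion\<close>

text \<open>
  A monomial of an element \<open>h + g\<close> that involves no vanishing variable does not occur in the part
  \<open>g\<close> from the monomial ideal. So it occurs in the kernel element \<open>h\<close>, hence together with another
  monomial of its fibre, of which there is none.
\<close>

lemma restricted_ideal_zero_of_small_displacement:
  assumes w: "w permutes {1..n}" and d: "small_displacement w"
  shows "restricted_matching_ideal n l w = {0 :: (nat set, 'k::idom) mpol}"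
proof
  define V where "V = pluecker_index n"
  define S where "S = vanishing_index n w"
  define R where "R = (poly_ring V :: (nat set, 'k) mpol ring)"
  interpret cring R unfolding R_def by (rule cring_poly_ring)
  have S: "S \<subseteq> V" by (auto simp: S_def V_def vanishing_index_def)
  show "restricted_matching_ideal n l w \<subseteq> {0 :: (nat set, 'k) mpol}"
  proof
    fix p :: "(nat set, 'k) mpol"
    assume "p \<in> restricted_matching_ideal n l w"
    then obtain h g where p: "p = h + g" "p \<in> polys_in (V - S)"
      and h: "h \<in> matching_ideal n l" and g: "g \<in> genideal R (var ` S)"
      by (auto simp: restricted_matching_ideal_def set_add_def' poly_ring_def V_def S_def R_def)
    have h_in: "h \<in> polys_in V" and h_0: "subst_hom (matching_monomial l) h = (0 :: (nat \<times> nat, 'k) mpol)"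
      using h by (auto simp: matching_ideal_def a_kernel_def' poly_ring_def V_def matching_map_def)
    have "Poly_Mapping.keys p = {}"
    proof (rule ccontr)
      assume "Poly_Mapping.keys p \<noteq> {}"
      then obtain m where m: "m \<in> Poly_Mapping.keys p" by blast
      then have m_in: "Poly_Mapping.keys m \<subseteq> V - S" using p(2) by (simp add: polys_in_def)
      then have "m \<notin> Poly_Mapping.keys g"
        using genideal_variables[OF S g[unfolded R_def]] by blast
      then have m_h: "m \<in> Poly_Mapping.keys h"
        using m p(1) by (simp add: in_keys_iff lookup_add)
      have unit: "of_int (sign (matching_field l J)) \<noteq> (0 :: 'k)" for J
        by (cases rule: sign_cases[of "matching_field l J"]) simp_all
      obtain m' where m': "m' \<in> Poly_Mapping.keys h" "m' \<noteq> m"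
        "term_exponent (matching_exponent l) m' = term_exponent (matching_exponent l) m"
        using subst_hom_terms_kernel[OF matching_monomial_single unit h_0 m_h] by blast
      moreover have "Poly_Mapping.keys m' \<subseteq> V" using h_in m'(1) by (simp add: polys_in_def)
      ultimately show False
        using nonvanishing_monomial_alone_in_fibre[OF w d, of m m' l] m_in by (simp add: V_def S_def)
    qed
    then show "p \<in> {0}" by simp
  qed
  have "ideal (genideal R (var ` S)) R"
    by (rule genideal_ideal) (use S in \<open>auto simp: R_def poly_ring_def\<close>)
  then have "0 \<in> genideal R (var ` S)"
    using additive_subgroup.zero_closed[OF ideal.axioms(1)] by (fastforce simp: R_def poly_ring_def)
  moreover have "0 \<in> (matching_ideal n l :: (nat set, 'k) mpol set)"
    by (simp add: matching_ideal_def a_kernel_def' poly_ring_def matching_map_def subst_hom_def polys_in_def)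
  ultimately show "{0} \<subseteq> (restricted_matching_ideal n l w :: (nat set, 'k) mpol set)"
    by (force simp: restricted_matching_ideal_def set_add_def' poly_ring_def V_def S_def R_def polys_in_def)
qed

theorem theoremB:
  fixes n l :: nat and w :: "nat \<Rightarrow> nat"
  assumes "n \<ge> 1" and "w permutes {1..n}" and "l \<le> n"
  shows "(restricted_matching_ideal n l w :: (nat set, 'k::field_char_0) mpol set) = {0}
           \<longleftrightarrow> w \<in> commuting_products n"
  unfolding commuting_products_iff[OF assms(2)]
  using restricted_ideal_zero_of_small_displacement[OF assms(2)]
    restricted_ideal_nonzero_of_large_displacement[OF assms(2)] by blast

end
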